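(* Let $\Phi$ be an $m\times N$ real matrix with unit-norm columns $\phi_1,\dots,\phi_N$, let $1\le k<N$, $\delta\in(0,1)$, $\epsilon\in(0,1)$. Put $\alpha=\frac{(1-\delta)^2}{8\log(2N/\epsilon)}$ and $g(\delta,t)=\exp\bigl(-(1-\delta)^2/(8t^2)\bigr)$. Suppose that $\Phi$ is $(k,\delta,\epsilon)$-StRIP and $(k,\delta,\alpha,\epsilon^2)$-WSINC with this function $g$. Let $\mathbf{x}$ be chosen from the generic random signal model $\mathcal{S}_k$, let $\mathbf{y}=\Phi\mathbf{x}$, and let $\hat{\mathbf{x}}$ be the approximation of $\mathbf{x}$ found by Basis Pursuit from $\mathbf{y}$. Let $I$ be the set of positions of the $k$ largest (in magnitude) coordinates of $\mathbf{x}$ and $I^c=[N]\setminus I$. Then with probability at least $1-4\epsilon$, $$\|\mathbf{x}_{I^c}-\hat{\mathbf{x}}_{I^c}\|_1\le4\min_{\mathbf{x}'\ k\text{-sparse}}\|\mathbf{x}-\mathbf{x}'\|_1 .$$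
   Context: $[N]=\{1,\dots,N\}$; $\log$ is the natural logarithm. $\Phi_I$ is the submatrix of $\Phi$ with columns indexed by $I$; $\mathbf{x}_I$ is the restriction of $\mathbf{x}$ to coordinates in $I$. A vector is $k$-sparse if it has at most $k$ nonzero coordinates. $\|\cdot\|$ on matrices is the spectral norm. Basis Pursuit (noiseless): $\hat{\mathbf{x}}$ is a minimizer of $\|\tilde{\mathbf{x}}\|_1$ over $\tilde{\mathbf{x}}\in\mathbb{R}^N$ subject to $\Phi\tilde{\mathbf{x}}=\mathbf{y}$. Generic random signal model $\mathcal{S}_k$: a random vector $\mathbf{x}\in\mathbb{R}^N$ such that (a) the set $I$ of locations of its $k$ coordinates of largest magnitude is uniformly distributed over all $k$-subsets of $[N]$; (b) conditional on $I$, the signs of $x_i$, $i\in I$, are i.i.d. uniform on $\{1,-1\}$. $\Phi$ is $(k,\delta,\epsilon)$-StRIP if, for $I$ a uniformly random $k$-subset of $[N]$, $\Pr(\|\Phi_I^T\Phi_I-\mathrm{Id}\|\le\delta)\ge1-\epsilon$. WSINC: let $A_\alpha(\Phi)$ be the set of $k$-subsets $I\subset[N]$ for which there is $i\in I^c$ with $\|\Phi_I^T\phi_i\|_2^2>\alpha$, and let $\mathcal{B}(\Phi)$ be the (finite) set of all values $\|\Phi_I^T\phi_i\|_2$ over $k$-subsets $I$ and $i\in I^c$. For a positive increasing function $g(\delta,\cdot)$, $\Phi$ is $(k,\delta,\alpha,\epsilon)$-WSINC if $$\sum_{t\in\mathcal{B}(\Phi)}\Pr\bigl(I\in A_\alpha(\Phi),\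 \|\Phi_I^T\phi_i\|_2=t\bigr)\,g(\delta,t)\le\frac{\epsilon}{N-k},$$ where $I$ is a uniformly random $k$-subset of $[N]$ and, given $I$, $i$ is uniform in $[N]\setminus I$. (For $t=0$ the value $g(\delta,0)$ is taken to be $0$.) *)

theory Defs
  imports "HOL-Probability.Probability"
begin

text \<open>
  An \<open>m \<times> N\<close> matrix is a \<^typ>\<open>real ^ 'n ^ 'm\<close>; the index set \<open>[N]\<close> is the finite type \<open>'n\<close>,
  so \<open>N = CARD('n)\<close>. Restrictions to an index set \<open>I\<close> are zero-padded: \<open>restrict_cols I A\<close>
  is the submatrix \<open>A\<^sub>I\<close> and \<open>restrict_vec I x\<close> is \<open>x\<^sub>I\<close>, with zeros off \<open>I\<close>. Padding by zero
  rows and columns changes neither vector norms nor operator norms.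
\<close>

definition restrict_cols :: "'n set \<Rightarrow> real ^ 'n ^ 'm \<Rightarrow> real ^ 'n ^ 'm" where
  "restrict_cols I A = (\<chi> r c. if c \<in> I then A $ r $ c else 0)"

definition restrict_vec :: "'n set \<Rightarrow> real ^ 'n \<Rightarrow> real ^ 'n" where
  "restrict_vec I x = (\<chi> i. if i \<in> I then x $ i else 0)"

definition l1_norm :: "real ^ 'n \<Rightarrow> real" where
  "l1_norm x = (\<Sum>i\<in>UNIV. \<bar>x $ i\<bar>)"

definition spectral_norm :: "real ^ 'n ^ 'm \<Rightarrow> real" where
  "spectral_norm A = onorm (\<lambda>v. A *v v)"

definition sparse :: "nat \<Rightarrow> real ^ 'n \<Rightarrow> bool" where
  "sparse k x \<longleftrightarrow> card {i. x $ i \<noteq> 0} \<le> k"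

text \<open>The infimum is attained: the \<open>k\<close>-sparse vectors form a finite union of linear subspaces.\<close>

definition best_sparse_l1_error :: "nat \<Rightarrow> real ^ 'n \<Rightarrow> real" where
  "best_sparse_l1_error k x = (INF x' \<in> {x'. sparse k x'}. l1_norm (x - x'))"

definition basis_pursuit :: "real ^ 'n ^ 'm \<Rightarrow> real ^ 'm \<Rightarrow> real ^ 'n \<Rightarrow> bool" where
  "basis_pursuit \<Phi> y xh \<longleftrightarrow> is_arg_min l1_norm (\<lambda>z. \<Phi> *v z = y) xh"

definition k_subsets :: "nat \<Rightarrow> 'n::finite set set" where
  "k_subsets k = {I. card I = k}"

text \<open>\<open>restrict_cols I (mat 1)\<close> is the (padded) identity on the coordinates in \<open>I\<close>.\<close>

definition StRIP :: "nat \<Rightarrow> real \<Rightarrow> real \<Rightarrow> real ^ 'n ^ 'm \<Rightarrow> bool" where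
  "StRIP k \<delta> \<epsilon> \<Phi> \<longleftrightarrow>
     measure_pmf.prob (pmf_of_set (k_subsets k))
       {I. spectral_norm (transpose (restrict_cols I \<Phi>) ** restrict_cols I \<Phi>
             - restrict_cols I (mat 1)) \<le> \<delta>}
     \<ge> 1 - \<epsilon>"

definition coherence :: "real ^ 'n ^ 'm \<Rightarrow> 'n set \<Rightarrow> 'n \<Rightarrow> real" where
  "coherence \<Phi> I i = norm (transpose (restrict_cols I \<Phi>) *v column i \<Phi>)"

definition incoherence_exceptions :: "nat \<Rightarrow> real \<Rightarrow> real ^ 'n ^ 'm \<Rightarrow> 'n set set" where
  "incoherence_exceptions k \<alpha> \<Phi> = {I \<in> k_subsets k. \<exists>i\<in>- I. (coherence \<Phi> I i)\<^sup>2 > \<alpha>}"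

definition coherence_values :: "nat \<Rightarrow> real ^ 'n ^ 'm \<Rightarrow> real set" where
  "coherence_values k \<Phi> = {coherence \<Phi> I i | I i. I \<in> k_subsets k \<and> i \<in> - I}"

definition random_subset_point :: "nat \<Rightarrow> ('n::finite set \<times> 'n) pmf" where
  "random_subset_point k =
     bind_pmf (pmf_of_set (k_subsets k)) (\<lambda>I. map_pmf (Pair I) (pmf_of_set (- I)))"

definition WSINC ::
  "(real \<Rightarrow> real \<Rightarrow> real) \<Rightarrow> nat \<Rightarrow> real \<Rightarrow> real \<Rightarrow> real \<Rightarrow> real ^ 'n ^ 'm \<Rightarrow> bool" where
  "WSINC g k \<delta> \<alpha> \<epsilon> \<Phi> \<longleftrightarrow>
     (\<Sum>t\<in>coherence_values k \<Phi>.
        measure_pmf.prob (random_subset_point k)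
          {(I, i). I \<in> incoherence_exceptions k \<alpha> \<Phi> \<and> coherence \<Phi> I i = t} * g \<delta> t)
     \<le> \<epsilon> / (real CARD('n) - real k)"

text \<open>The case distinction is needed because \<open>exp (- c / 0) = 1\<close> in HOL.\<close>

definition exp_weight :: "real \<Rightarrow> real \<Rightarrow> real" where
  "exp_weight \<delta> t = (if t = 0 then 0 else exp (- ((1 - \<delta>)\<^sup>2 / (8 * t\<^sup>2))))"

definition largest_coords :: "nat \<Rightarrow> real ^ 'n \<Rightarrow> 'n set \<Rightarrow> bool" where
  "largest_coords k x J \<longleftrightarrow> card J = k \<and> (\<forall>i\<in>J. \<forall>j\<in>- J. \<bar>x $ j\<bar> \<le> \<bar>x $ i\<bar>)"

text \<open>
  If magnitudes tie, the set of positions of the \<open>k\<close> largest coordinates is not determined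
  by the vector. It is therefore carried along as a random set \<open>I\<close>, which may resolve ties
  in any way. Conditioning on the event \<open>I = J\<close> is \<^const>\<open>uniform_measure\<close>.
\<close>

definition generic_signal ::
  "'a measure \<Rightarrow> nat \<Rightarrow> ('a \<Rightarrow> real ^ 'n) \<Rightarrow> ('a \<Rightarrow> 'n::finite set) \<Rightarrow> bool" where
  "generic_signal M k x I \<longleftrightarrow>
     x \<in> borel_measurable M \<and>
     I \<in> measurable M (count_space UNIV) \<and>
     (\<forall>\<omega>\<in>space M. largest_coords k (x \<omega>) (I \<omega>)) \<and>
     distr M (count_space UNIV) I = measure_pmf (pmf_of_set (k_subsets k)) \<and>
     (\<forall>J\<in>k_subsets k.
        let C = uniform_measure M {\<omega> \<in> space M. I \<omega> = J} in
          prob_space.indep_vars C (\<lambda>_. borel) (\<lambda>i \<omega>. sgn (x \<omega> $ i)) J \<and>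
          (\<forall>i\<in>J. measure C {\<omega> \<in> space C. sgn (x \<omega> $ i) = 1} = 1 / 2 \<and>
                 measure C {\<omega> \<in> space C. sgn (x \<omega> $ i) = - 1} = 1 / 2))"

end

theory Submission
  imports Defs
begin

text \<open>
  If \<open>\<Phi>\<close> is well conditioned on the support \<open>J\<close>, each column \<open>\<phi>\<^sub>i\<close> off \<open>J\<close> has a coefficient
  vector \<open>b\<^sub>i = (\<Phi>\<^sub>J\<^sup>T \<Phi>\<^sub>J)\<^sup>-\<^sup>1 \<Phi>\<^sub>J\<^sup>T \<phi>\<^sub>i\<close> of norm at most \<open>coherence / (1 - \<delta>)\<close>, and every \<open>h\<close> in the kernel
  satisfies \<open>h\<^sub>J = - (\<Sum>i\<notin>J. h\<^sub>i b\<^sub>i)\<close>. Once \<open>\<bar>\<langle>sgn x\<^sub>J, b\<^sub>i\<rangle>\<bar> \<le> 1/2\<close> for all these \<open>i\<close>, minimality of the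
  \<open>l\<^sub>1\<close> norm bounds the error off \<open>J\<close> by four times the tail of \<open>x\<close>. By Hoeffding's inequality the
  condition fails at \<open>i\<close> with probability at most twice the weight in WSINC. Supports outside the
  exceptional set contribute at most \<open>\<epsilon>\<close> by the choice of \<open>\<alpha>\<close>, exceptional ones at most \<open>2\<epsilon>\<^sup>2\<close> by WSINC,
  and ill-conditioned ones at most \<open>\<epsilon>\<close> by StRIP.
\<close>

section \<open>Best sparse approximation\<close>

lemma l1_norm_restrict_vec: "l1_norm (restrict_vec J x) = (\<Sum>i\<in>J. \<bar>x $ i\<bar>)"
proof -
  have "l1_norm (restrict_vec J x) = (\<Sum>i\<in>UNIV. if i \<in> J then \<bar>x $ i\<bar> else 0)"
    unfolding l1_norm_def restrict_vec_def by (intro sum.cong) auto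
  then show ?thesis by (simp add: sum.If_cases)
qed

text \<open>Exchange argument: as \<open>card S\<close> is at most \<open>card J\<close>,
  \<open>S - J\<close> injects into \<open>J - S\<close>. Every index of \<open>J\<close> has
  magnitude at least that of any index outside, so moving along the injection can only increase the
  sum.\<close>

lemma largest_coords_sum_le:
  fixes x :: "real ^ 'n"
  assumes J: "largest_coords k x J" and S: "card S \<le> k"
  shows "(\<Sum>i\<in>S. \<bar>x $ i\<bar>) \<le> (\<Sum>i\<in>J. \<bar>x $ i\<bar>)"
proof -
  have card: "card S = card (S \<inter> J) + card (S - J)" "card J = card (S \<inter> J) + card (J - S)"
    using card_Int_Diff[of S J] card_Int_Diff[of J S] by (simp_all add: Int_commute)
  with J S have "card (S - J) \<le> card (J - S)"
    by (simp add: largest_coords_def)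
  then obtain f where f: "f ` (S - J) \<subseteq> J - S" "inj_on f (S - J)"
    using card_le_inj[of "S - J" "J - S"] by auto
  have "(\<Sum>i\<in>S - J. \<bar>x $ i\<bar>) \<le> (\<Sum>i\<in>S - J. \<bar>x $ f i\<bar>)"
    using J f(1) by (intro sum_mono) (auto simp: largest_coords_def)
  also have "\<dots> = (\<Sum>i\<in>f ` (S - J). \<bar>x $ i\<bar>)"
    using f(2) by (simp add: sum.reindex)
  also have "\<dots> \<le> (\<Sum>i\<in>J - S. \<bar>x $ i\<bar>)"
    using f(1) by (intro sum_mono2) auto
  finally have "(\<Sum>i\<in>S \<inter> J. \<bar>x $ i\<bar>) + (\<Sum>i\<in>S - J. \<bar>x $ i\<bar>)
      \<le> (\<Sum>i\<in>J \<inter> S. \<bar>x $ i\<bar>) + (\<Sum>i\<in>J - S. \<bar>x $ i\<bar>)"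
    by (simp add: Int_commute)
  then show ?thesis
    by (simp add: sum.Int_Diff[symmetric])
qed

text \<open>A sparse \<open>x'\<close> leaves \<open>x\<close> unchanged off its support
  \<open>?S\<close>, so its error is at least the mass of \<open>x\<close> there. No set of at most
  \<open>k\<close> indices captures more mass than \<open>J\<close>, hence none leaves less
  outside.\<close>

lemma tail_le_best_sparse_l1_error:
  fixes x :: "real ^ 'n"
  assumes J: "largest_coords k x J"
  shows "(\<Sum>i\<in>- J. \<bar>x $ i\<bar>) \<le> best_sparse_l1_error k x"
  unfolding best_sparse_l1_error_def
proof (rule cINF_greatest)
  have "sparse k (0 :: real ^ 'n)" by (simp add: sparse_def)
  then show "{x' :: real ^ 'n. sparse k x'} \<noteq> {}" by blast
next
  fix x' :: "real ^ 'n" assume "x' \<in> {x'. sparse k x'}"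
  then have S: "card {i. x' $ i \<noteq> 0} \<le> k" (is "card ?S \<le> k")
    by (simp add: sparse_def)
  have compl: "(\<Sum>i\<in>- A. \<bar>x $ i\<bar>) = (\<Sum>i\<in>UNIV. \<bar>x $ i\<bar>) - (\<Sum>i\<in>A. \<bar>x $ i\<bar>)" for A
    by (simp add: sum_diff Compl_eq_Diff_UNIV)
  have "(\<Sum>i\<in>- J. \<bar>x $ i\<bar>) \<le> (\<Sum>i\<in>- ?S. \<bar>x $ i\<bar>)"
    using largest_coords_sum_le[OF J S] unfolding compl by simp
  also have "\<dots> = (\<Sum>i\<in>- ?S. \<bar>(x - x') $ i\<bar>)"
    by (intro sum.cong) auto
  also have "\<dots> \<le> l1_norm (x - x')"
    unfolding l1_norm_def by (intro sum_mono2) auto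
  finally show "(\<Sum>i\<in>- J. \<bar>x $ i\<bar>) \<le> l1_norm (x - x')" .
qed

section \<open>Recovery from a well-conditioned support\<close>

lemma restrict_cols_mult_vec:
  "restrict_cols J A *v v = A *v restrict_vec J v"
  by (simp add: vec_eq_iff matrix_vector_mult_def restrict_cols_def restrict_vec_def if_distrib
      cong: if_cong sum.cong) (auto intro!: sum.cong)

lemma restrict_cols_transpose_mult_vec:
  "transpose (restrict_cols J A) *v v = restrict_vec J (transpose A *v v)"
  by (auto simp: vec_eq_iff matrix_vector_mult_def restrict_cols_def restrict_vec_def transpose_def)

lemma restrict_vec_idem [simp]: "restrict_vec J (restrict_vec J v) = restrict_vec J v"
  by (simp add: vec_eq_iff restrict_vec_def)

text \<open>
  Filling the zero-padded Gram matrix with the identity off \<open>J\<close> gives a small perturbation of the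
  identity on the whole space, hence an invertible matrix.
\<close>

lemma gram_projection_coefficients:
  fixes A :: "real ^ 'n ^ 'm" and J :: "'n set"
  assumes \<delta>: "\<delta> < 1"
    and rip: "spectral_norm (transpose (restrict_cols J A) ** restrict_cols J A
      - restrict_cols J (mat 1)) \<le> \<delta>"
  shows "\<exists>b. (\<forall>i. restrict_vec J (b i) = b i)
    \<and> (\<forall>i. (1 - \<delta>) * norm (b i) \<le> coherence A J i)
    \<and> (\<forall>h. A *v h = 0 \<longrightarrow> restrict_vec J h = - (\<Sum>i\<in>- J. h $ i *\<^sub>R b i))"
proof -
  define P where "P = restrict_cols J A"
  define F where "F = transpose P ** P - restrict_cols J (mat 1)"
  define H where "H = mat 1 + F"
  have Hv: "H *v v = transpose P *v (P *v v) + (v - restrict_vec J v)" for v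
    by (simp add: H_def F_def matrix_vector_mult_add_rdistrib matrix_vector_mult_diff_rdistrib
        restrict_cols_mult_vec flip: matrix_vector_mul_assoc)
  \<comment> \<open>\<open>H\<close> differs from the identity by \<open>F\<close>, of operator norm
    at most \<delta>. This one bound yields both the injectivity of \<open>H\<close> and the norm
    estimate for the coefficient vectors.\<close>
  have lower: "(1 - \<delta>) * norm v \<le> norm (H *v v)" for v
  proof -
    have "norm (F *v v) \<le> onorm ((*v) F) * norm v"
      by (rule onorm) simp
    also have "\<dots> \<le> \<delta> * norm v"
      using rip by (intro mult_right_mono) (simp_all add: F_def P_def spectral_norm_def)
    finally have "norm v \<le> norm (v + F *v v) + \<delta> * norm v"
      using norm_triangle_ineq4[of "v + F *v v" "F *v v"] by simp
    then show ?thesis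
      by (simp add: H_def matrix_vector_mult_add_rdistrib algebra_simps)
  qed
  have ker: "v = 0" if "H *v v = 0" for v
    using lower[of v] that \<delta> by (simp add: mult_le_0_iff)
  then have "\<exists>B. H ** B = mat 1"
    using matrix_left_invertible_ker[of H] by (auto simp: matrix_left_right_inverse[of H])
  then obtain B where B: "H ** B = mat 1" by blast
  define b where "b i = B *v (transpose P *v column i A)" for i
  have Hb: "H *v b i = transpose P *v column i A" for i
    unfolding b_def by (simp add: matrix_vector_mul_assoc B)
  \<comment> \<open>At a coordinate \<open>j\<close> off \<open>J\<close> both the Gram term and the
    right-hand side of \<open>Hb\<close> vanish, so the equation reads
    \<open>b i $ j = 0\<close>.\<close>
  have "restrict_vec J (b i) = b i" for i
  proof -
    have "b i $ j = 0" if "j \<notin> J" for j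
      using arg_cong[OF Hb[of i], of "\<lambda>v. v $ j"] that
      by (simp add: Hv P_def restrict_cols_transpose_mult_vec restrict_vec_def del: transpose_matrix_vector)
    then show ?thesis
      by (auto simp: vec_eq_iff restrict_vec_def)
  qed
  moreover have "(1 - \<delta>) * norm (b i) \<le> coherence A J i" for i
    using lower[of "b i"] by (simp add: Hb P_def coherence_def)
  moreover have "restrict_vec J h = - (\<Sum>i\<in>- J. h $ i *\<^sub>R b i)" if "A *v h = 0" for h
  proof -
    have "A *v h = A *v restrict_vec J h + (\<Sum>i\<in>- J. h $ i *\<^sub>R column i A)"
    proof -
      have "A *v h = (\<Sum>i\<in>UNIV. h $ i *\<^sub>R column i A)" for h
        by (simp add: matrix_mult_sum scalar_mult_eq_scaleR)
      moreover have "(\<Sum>i\<in>UNIV. h $ i *\<^sub>R column i A)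
          = (\<Sum>i\<in>UNIV. restrict_vec J h $ i *\<^sub>R column i A)
            + (\<Sum>i\<in>UNIV. if i \<in> - J then h $ i *\<^sub>R column i A else 0)"
        unfolding sum.distrib[symmetric] by (intro sum.cong) (auto simp: restrict_vec_def)
      ultimately show ?thesis by (simp add: sum.If_cases Compl_eq)
    qed
    then have Ph: "P *v restrict_vec J h = - (\<Sum>i\<in>- J. h $ i *\<^sub>R column i A)"
      using that by (simp add: P_def restrict_cols_mult_vec add_eq_0_iff2)
    \<comment> \<open>Both sides of the claimed kernel identity have the same image under
      \<open>H\<close>; injectivity then identifies them.\<close>
    have "H *v restrict_vec J h = transpose P *v - (\<Sum>i\<in>- J. h $ i *\<^sub>R column i A)"
      by (simp only: Hv Ph restrict_vec_idem) simp
    also have "\<dots> = - (\<Sum>i\<in>- J. h $ i *\<^sub>R (H *v b i))"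
      unfolding Hb by (simp add: linear_neg linear_sum linear_scale matrix_vector_mul_linear
          del: transpose_matrix_vector)
    finally have "H *v restrict_vec J h = - (\<Sum>i\<in>- J. h $ i *\<^sub>R (H *v b i))" .
    then have "H *v (restrict_vec J h + (\<Sum>i\<in>- J. h $ i *\<^sub>R b i)) = 0"
      by (simp add: matrix_vector_right_distrib linear_sum linear_scale matrix_vector_mul_linear)
    from ker[OF this] show ?thesis by (simp add: add_eq_0_iff2)
  qed
  ultimately show ?thesis by (intro exI[of _ b]) simp
qed

text \<open>With \<open>h = xh - x\<close>, minimality bounds the mass of \<open>h\<close> off
  \<open>J\<close> by twice the tail of \<open>x\<close> minus the pairing of \<open>h\<close> with
  the signs on \<open>J\<close>. By \<open>ker\<close> and \<open>cert\<close> that pairing costs at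
  most half of the same mass; absorbing this half turns the factor 2 into 4.\<close>

lemma basis_pursuit_error_le:
  fixes x xh :: "real ^ 'n"
  assumes bp: "basis_pursuit \<Phi> (\<Phi> *v x) xh"
    and ker: "\<And>h. \<Phi> *v h = 0 \<Longrightarrow> restrict_vec J h = - (\<Sum>i\<in>- J. h $ i *\<^sub>R b i)"
    and cert: "\<And>i. i \<in> - J \<Longrightarrow> \<bar>\<Sum>j\<in>J. b i $ j * sgn (x $ j)\<bar> \<le> 1 / 2"
  shows "(\<Sum>i\<in>- J. \<bar>x $ i - xh $ i\<bar>) \<le> 4 * (\<Sum>i\<in>- J. \<bar>x $ i\<bar>)"
proof -
  define h where "h = xh - x"
  have "\<Phi> *v h = 0"
    using bp by (simp add: h_def basis_pursuit_def is_arg_min_def matrix_vector_mult_diff_distrib)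
  from ker[OF this] have h: "h $ j = - (\<Sum>i\<in>- J. h $ i * b i $ j)" if "j \<in> J" for j
    using that by (simp add: vec_eq_iff restrict_vec_def split: if_splits)
  \<comment> \<open>The kernel identity trades the entries of \<open>h\<close> on \<open>J\<close>
    for those off \<open>J\<close>. After exchanging the sums, the multiplier of
    \<open>h $ i\<close> is exactly the quantity controlled by \<open>cert\<close>.\<close>
  have "(\<Sum>j\<in>J. sgn (x $ j) * h $ j) = - (\<Sum>j\<in>J. \<Sum>i\<in>- J. h $ i * (b i $ j * sgn (x $ j)))"
    unfolding sum_negf[symmetric] by (intro sum.cong) (auto simp: h sum_distrib_left sum_negf mult_ac)
  also have "(\<Sum>j\<in>J. \<Sum>i\<in>- J. h $ i * (b i $ j * sgn (x $ j)))
      = (\<Sum>i\<in>- J. h $ i * (\<Sum>j\<in>J. b i $ j * sgn (x $ j)))"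
    by (subst sum.swap) (simp add: sum_distrib_left)
  finally have "- (\<Sum>j\<in>J. sgn (x $ j) * h $ j)
      \<le> \<bar>\<Sum>i\<in>- J. h $ i * (\<Sum>j\<in>J. b i $ j * sgn (x $ j))\<bar>"
    by simp
  also have "\<dots> \<le> (\<Sum>i\<in>- J. \<bar>h $ i * (\<Sum>j\<in>J. b i $ j * sgn (x $ j))\<bar>)"
    by (rule sum_abs)
  also have "\<dots> \<le> (\<Sum>i\<in>- J. \<bar>h $ i\<bar> * (1 / 2))"
    unfolding abs_mult by (intro sum_mono mult_left_mono cert) auto
  finally have on: "- (\<Sum>j\<in>J. sgn (x $ j) * h $ j) \<le> (\<Sum>i\<in>- J. \<bar>h $ i\<bar>) / 2"
    by (simp add: sum_distrib_right sum_divide_distrib)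
  have "l1_norm xh \<le> l1_norm x"
    using bp by (auto simp: basis_pursuit_def is_arg_min_linorder)
  then have "(\<Sum>i\<in>J. \<bar>x $ i + h $ i\<bar>) + (\<Sum>i\<in>- J. \<bar>x $ i + h $ i\<bar>)
      \<le> (\<Sum>i\<in>J. \<bar>x $ i\<bar>) + (\<Sum>i\<in>- J. \<bar>x $ i\<bar>)"
    by (simp add: l1_norm_def h_def sum.subset_diff[of J UNIV] Compl_eq_Diff_UNIV)
  \<comment> \<open>The sign is a subgradient of the absolute value; this includes
    \<open>x $ i = 0\<close>, where \<open>sgn\<close> is 0.\<close>
  moreover have "(\<Sum>i\<in>J. \<bar>x $ i\<bar> + sgn (x $ i) * h $ i) \<le> (\<Sum>i\<in>J. \<bar>x $ i + h $ i\<bar>)"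
    by (intro sum_mono) (auto simp: sgn_if)
  moreover have "(\<Sum>i\<in>- J. \<bar>h $ i\<bar> - \<bar>x $ i\<bar>) \<le> (\<Sum>i\<in>- J. \<bar>x $ i + h $ i\<bar>)"
    by (intro sum_mono) auto
  moreover have "(\<Sum>i\<in>- J. \<bar>x $ i - xh $ i\<bar>) = (\<Sum>i\<in>- J. \<bar>h $ i\<bar>)"
    by (simp add: h_def abs_minus_commute)
  ultimately show ?thesis
    using on by (simp add: sum.distrib sum_subtractf)
qed

section \<open>Random supports and random signs\<close>

text \<open>All complements have the same size \<open>N - k\<close>, so choosing first the subset
  and then a point outside it is uniform on pairs.\<close>

lemma random_subset_point_eq_pmf_of_set:
  assumes "k < CARD('n::finite)"
  shows "random_subset_point k = pmf_of_set (SIGMA J:(k_subsets k :: 'n set set). - J)"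
proof -
  have ne: "- J \<noteq> {}" and card: "card (- J) = CARD('n) - k"
    if "J \<in> k_subsets k" for J :: "'n set"
    using that assms by (auto simp: k_subsets_def Compl_eq_Diff_UNIV card_Diff_subset top.extremum_unique)
  have K: "k_subsets k \<noteq> ({} :: 'n set set)"
    using assms ex_card[of k "UNIV :: 'n set"] by (auto simp: k_subsets_def)
  have "(SIGMA J:(k_subsets k :: 'n set set). - J) = (\<Union>J\<in>k_subsets k. Pair J ` (- J))"
    by auto
  also have "pmf_of_set \<dots> = bind_pmf (pmf_of_set (k_subsets k)) (\<lambda>J. pmf_of_set (Pair J ` (- J)))"
    by (rule pmf_of_set_UN[where n = "CARD('n) - k"])
      (auto simp: K ne card card_image inj_on_def disjoint_family_on_def)
  also have "\<dots> = random_subset_point k"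
    unfolding random_subset_point_def
    by (intro bind_pmf_cong) (auto simp: map_pmf_of_set_inj ne inj_on_def K)
  finally show ?thesis by simp
qed

text \<open>Grouping the pairs by their coherence undoes the sum over values \<open>t\<close>. There
  are \<open>card (k_subsets k) * (N - k)\<close> equally likely pairs, so \<open>N - k\<close>
  cancels. The resulting double sum is the form that a union bound produces.\<close>

lemma WSINC_iff:
  fixes \<Phi> :: "real ^ 'n ^ 'm"
  assumes k: "k < CARD('n)"
  shows "WSINC g k \<delta> \<alpha> \<eta> \<Phi> \<longleftrightarrow>
    (\<Sum>J\<in>incoherence_exceptions k \<alpha> \<Phi>. \<Sum>i\<in>- J. g \<delta> (coherence \<Phi> J i))
      \<le> \<eta> * real (card (k_subsets k :: 'n set set))"
proof -
  let ?K = "k_subsets k :: 'n set set" and ?E = "incoherence_exceptions k \<alpha> \<Phi>"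
  define S where "S = (SIGMA J:?K. - J)"
  define S' where "S' = (SIGMA J:?E. - J)"
  have EK: "?E \<subseteq> ?K"
    by (auto simp: incoherence_exceptions_def)
  have K: "?K \<noteq> {}"
    using k ex_card[of k "UNIV :: 'n set"] by (auto simp: k_subsets_def)
  have cardS: "card S = card ?K * (CARD('n) - k)"
    unfolding S_def by (subst card_SigmaI) (auto simp: k_subsets_def Compl_eq_Diff_UNIV card_Diff_subset)
  then have S: "S \<noteq> {}"
    using K k by (metis card.empty card_eq_0_iff finite mult_is_0 zero_less_diff less_irrefl)
  have "(\<Sum>t\<in>coherence_values k \<Phi>. measure_pmf.prob (random_subset_point k)
      {(I, i). I \<in> ?E \<and> coherence \<Phi> I i = t} * g \<delta> t)
    = (\<Sum>t\<in>coherence_values k \<Phi>. (\<Sum>p\<in>{p \<in> S'. case_prod (coherence \<Phi>) p = t}.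
        g \<delta> (case_prod (coherence \<Phi>) p)) / card S)"
  proof (intro sum.cong refl)
    fix t
    have "S \<inter> {(I, i). I \<in> ?E \<and> coherence \<Phi> I i = t}
        = {p \<in> S'. case_prod (coherence \<Phi>) p = t}"
      using EK by (auto simp: S_def S'_def)
    then have "measure_pmf.prob (random_subset_point k)
        {(I, i). I \<in> ?E \<and> coherence \<Phi> I i = t}
      = card {p \<in> S'. case_prod (coherence \<Phi>) p = t} / card S"
      using S by (simp add: random_subset_point_eq_pmf_of_set[OF k] measure_pmf_of_set flip: S_def)
    \<comment> \<open>The weight is constant on the fibre over \<open>t\<close>, so cardinality
      times weight is a sum over the fibre.\<close>
    then show "measure_pmf.prob (random_subset_point k)
        {(I, i). I \<in> ?E \<and> coherence \<Phi> I i = t} * g \<delta> t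
      = (\<Sum>p\<in>{p \<in> S'. case_prod (coherence \<Phi>) p = t}. g \<delta> (case_prod (coherence \<Phi>) p)) / card S"
      by simp
  qed
  also have "\<dots> = (\<Sum>p\<in>S'. g \<delta> (case_prod (coherence \<Phi>) p)) / card S"
    unfolding sum_divide_distrib[symmetric]
  proof (subst sum.group)
    have "coherence_values k \<Phi> \<subseteq> case_prod (coherence \<Phi>) ` UNIV"
      by (auto simp: coherence_values_def)
    then show "finite (coherence_values k \<Phi>)"
      by (rule finite_subset) simp
    show "case_prod (coherence \<Phi>) ` S' \<subseteq> coherence_values k \<Phi>"
      using EK by (auto simp: S'_def coherence_values_def)
  qed simp_all
  also have "(\<Sum>p\<in>S'. g \<delta> (case_prod (coherence \<Phi>) p))
      = (\<Sum>J\<in>?E. \<Sum>i\<in>- J. g \<delta> (coherence \<Phi> J i))"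
    unfolding S'_def by (subst sum.Sigma) (auto simp: case_prod_unfold)
  finally have "WSINC g k \<delta> \<alpha> \<eta> \<Phi> \<longleftrightarrow>
      (\<Sum>J\<in>?E. \<Sum>i\<in>- J. g \<delta> (coherence \<Phi> J i)) / card S \<le> \<eta> / (real CARD('n) - real k)"
    by (simp only: WSINC_def)
  moreover have "0 < real (card ?K)" "0 < real CARD('n) - real k"
    using K k by (simp_all add: card_gt_0_iff)
  ultimately show ?thesis
    using k by (simp add: cardS of_nat_diff divide_le_cancel pos_divide_le_eq
        flip: divide_divide_eq_left)
qed

text \<open>A degenerate weight vector \<open>c\<close> has to be excluded, as the bound would read \<open>exp (- a\<^sup>2 / 0) = 1\<close>.\<close>

lemma (in prob_space) random_signs_tail_bound:
  fixes X :: "'i \<Rightarrow> 'a \<Rightarrow> real"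
  assumes J: "finite J" and indep: "indep_vars (\<lambda>_. borel) X J"
    and plus: "\<And>j. j \<in> J \<Longrightarrow> prob {\<omega> \<in> space M. X j \<omega> = 1} = 1 / 2"
    and minus: "\<And>j. j \<in> J \<Longrightarrow> prob {\<omega> \<in> space M. X j \<omega> = - 1} = 1 / 2"
    and a: "0 \<le> a" and c: "0 < (\<Sum>j\<in>J. (c j)\<^sup>2)"
  shows "prob {\<omega> \<in> space M. \<bar>\<Sum>j\<in>J. c j * X j \<omega>\<bar> \<ge> a} \<le> 2 * exp (- (a\<^sup>2 / (2 * (\<Sum>j\<in>J. (c j)\<^sup>2))))"
proof -
  have rv [measurable]: "X j \<in> borel_measurable M" if "j \<in> J" for j
    using indep that by (auto simp: indep_vars_def)
  \<comment> \<open>The two sign events are disjoint and of probability 1/2 each, so they exhaust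
    the space up to a null set.\<close>
  have AE_sign: "AE \<omega> in M. X j \<omega> = 1 \<or> X j \<omega> = - 1" if j: "j \<in> J" for j
  proof -
    note [measurable] = rv[OF j]
    have "prob ({\<omega> \<in> space M. X j \<omega> = 1} \<union> {\<omega> \<in> space M. X j \<omega> = - 1}) = 1 / 2 + 1 / 2"
      by (subst finite_measure_Union) (auto simp: plus[OF j] minus[OF j])
    then have "AE \<omega> in M. \<omega> \<in> {\<omega> \<in> space M. X j \<omega> = 1} \<union> {\<omega> \<in> space M. X j \<omega> = - 1}"
      by (intro AE_prob_1) simp
    then show ?thesis by eventually_elim auto
  qed
  have mean: "expectation (X j) = 0" if j: "j \<in> J" for j
  proof -
    note [measurable] = rv[OF j]
    \<comment> \<open>Almost surely \<open>X j\<close> is the difference of the indicators of its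
      two sign events.\<close>
    have "expectation (X j) = expectation (\<lambda>\<omega>. indicator {\<omega> \<in> space M. X j \<omega> = 1} \<omega>
        - indicator {\<omega> \<in> space M. X j \<omega> = - 1} \<omega>)"
      by (intro integral_cong_AE eventually_mono[OF eventually_conj[OF AE_sign[OF j] AE_space]])
        (auto simp: indicator_def)
    also have "\<dots> = 0"
      by (subst Bochner_Integration.integral_diff)
        (auto simp: plus[OF j] minus[OF j] Int_absorb2 less_top[symmetric]
          intro!: integrable_real_indicator)
    finally show ?thesis .
  qed
  interpret Hoeffding_ineq M J "\<lambda>j \<omega>. c j * X j \<omega>" "\<lambda>j. - \<bar>c j\<bar>" "\<lambda>j. \<bar>c j\<bar>"
    "\<Sum>j\<in>J. expectation (\<lambda>\<omega>. c j * X j \<omega>)"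
  proof unfold_locales
    show "indep_vars (\<lambda>_. borel) (\<lambda>j \<omega>. c j * X j \<omega>) J"
      by (intro indep_vars_compose2[OF indep]) simp
    show "AE \<omega> in M. c j * X j \<omega> \<in> {- \<bar>c j\<bar>..\<bar>c j\<bar>}" if "j \<in> J" for j
      using AE_sign[OF that] by eventually_elim auto
  qed (use J in auto)
  \<comment> \<open>The summands range over intervals of width \<open>2 * \<bar>c j\<bar>\<close>;
    the resulting 4 against the 2 in Hoeffding's exponent leaves the 2 in the denominator.\<close>
  have sq: "(\<Sum>j\<in>J. (\<bar>c j\<bar> - - \<bar>c j\<bar>)\<^sup>2) = 4 * (\<Sum>j\<in>J. (c j)\<^sup>2)"
    by (simp add: power_mult_distrib sum_distrib_left)
  show ?thesis
    using Hoeffding_ineq_abs_ge[OF a] c unfolding sq by (simp add: mean field_simps)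
qed

section \<open>Union bound over supports and columns off the support\<close>

theorem theorem2p5:
  fixes \<Phi> :: "real ^ 'n ^ 'm" and k :: nat and \<delta> \<epsilon> \<alpha> :: real
    and M :: "'a measure" and x xh :: "'a \<Rightarrow> real ^ 'n" and y :: "'a \<Rightarrow> real ^ 'm"
    and I :: "'a \<Rightarrow> 'n set"
  assumes "\<And>i. norm (column i \<Phi>) = 1"
    and "1 \<le> k" and "k < CARD('n)"
    and "0 < \<delta>" and "\<delta> < 1" and "0 < \<epsilon>" and "\<epsilon> < 1"
    and "\<alpha> = (1 - \<delta>)\<^sup>2 / (8 * ln (2 * real CARD('n) / \<epsilon>))"
    and "StRIP k \<delta> \<epsilon> \<Phi>"
    and "WSINC exp_weight k \<delta> \<alpha> (\<epsilon>\<^sup>2) \<Phi>"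
    and "prob_space M"
    and "generic_signal M k x I"
    and "\<And>\<omega>. \<omega> \<in> space M \<Longrightarrow> y \<omega> = \<Phi> *v x \<omega>"
    and "\<And>\<omega>. \<omega> \<in> space M \<Longrightarrow> basis_pursuit \<Phi> (y \<omega>) (xh \<omega>)"
  shows "\<exists>E\<in>sets M. measure M E \<ge> 1 - 4 * \<epsilon> \<and>
           (\<forall>\<omega>\<in>E. l1_norm (restrict_vec (- I \<omega>) (x \<omega>) - restrict_vec (- I \<omega>) (xh \<omega>))
                    \<le> 4 * best_sparse_l1_error k (x \<omega>))"
proof -
  interpret prob_space M by fact
  define K where "K = (k_subsets k :: 'n set set)"
  define G where "G = {J :: 'n set. spectral_norm (transpose (restrict_cols J \<Phi>) ** restrict_cols J \<Phi>
    - restrict_cols J (mat 1)) \<le> \<delta>}"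
  define w where "w J i = exp_weight \<delta> (coherence \<Phi> J i)" for J i
  have K: "K \<noteq> {}"
    using assms(3) ex_card[of k "UNIV :: 'n set"] by (auto simp: K_def k_subsets_def)
  then have cK: "0 < card K" by (simp add: card_gt_0_iff)
  have "\<forall>J\<in>G. \<exists>b. (\<forall>i. restrict_vec J (b i) = b i)
      \<and> (\<forall>i. (1 - \<delta>) * norm (b i) \<le> coherence \<Phi> J i)
      \<and> (\<forall>h. \<Phi> *v h = 0 \<longrightarrow> restrict_vec J h = - (\<Sum>i\<in>- J. h $ i *\<^sub>R b i))"
    (is "\<forall>J\<in>G. \<exists>b. ?coeffs J b")
    unfolding G_def Ball_def mem_Collect_eq
    by (intro allI impI gram_projection_coefficients[OF \<open>\<delta> < 1\<close>])
  then obtain b where b: "\<forall>J\<in>G. ?coeffs J (b J)"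
    by (rule bchoice[THEN exE])
  have supp: "restrict_vec J (b J i) = b J i"
    and norm_b: "(1 - \<delta>) * norm (b J i) \<le> coherence \<Phi> J i"
    and ker_b: "\<Phi> *v h = 0 \<Longrightarrow> restrict_vec J h = - (\<Sum>i\<in>- J. h $ i *\<^sub>R b J i)"
    if "J \<in> G" for J i h
    using bspec[OF b that] by blast+
  have x [measurable]: "x \<in> borel_measurable M" and I [measurable]: "I \<in> measurable M (count_space UNIV)"
    and largest: "\<And>\<omega>. \<omega> \<in> space M \<Longrightarrow> largest_coords k (x \<omega>) (I \<omega>)"
    and distr_I: "distr M (count_space UNIV) I = measure_pmf (pmf_of_set K)"
    using assms(12) by (auto simp: generic_signal_def K_def)
  have xi [measurable]: "(\<lambda>\<omega>. x \<omega> $ i) \<in> borel_measurable M" for i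
    by (rule borel_measurable_continuous_on[OF _ x]) (intro continuous_intros)
  have prob_I: "prob {\<omega> \<in> space M. I \<omega> \<in> A} = measure_pmf.prob (pmf_of_set K) A" for A
    unfolding distr_I[symmetric] by (subst measure_distr) (auto intro!: arg_cong[where f = prob])
  \<comment> \<open>The coefficients \<open>b J i\<close> depend on the support alone, not on the
    signs. Conditionally on \<open>I = J\<close> the sum is therefore a fixed linear combination of
    independent signs.\<close>
  define bad where "bad J i = {\<omega> \<in> space M. I \<omega> = J
    \<and> 1 / 2 < \<bar>\<Sum>j\<in>J. b J i $ j * sgn (x \<omega> $ j)\<bar>}" for J i
  have bad_sets [measurable]: "bad J i \<in> events" for J i
    unfolding bad_def by measurable
  have bad_le: "prob (bad J i) \<le> 2 * w J i / card K" if J: "J \<in> K" "J \<in> G" for J i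
  proof (cases "b J i = 0")
    case True
    then have "bad J i = {}" by (simp add: bad_def)
    then show ?thesis by (simp add: w_def exp_weight_def)
  next
    case False
    define A where "A = {\<omega> \<in> space M. I \<omega> = J}"
    define C where "C = uniform_measure M A"
    have A [measurable]: "A \<in> events" unfolding A_def by measurable
    \<comment> \<open>Uniformity of the support gives \<open>A\<close> positive mass, so
      conditioning is legitimate, and supplies the factor \<open>1 / card K\<close>.\<close>
    have prob_A: "prob A = 1 / card K"
      using prob_I[of "{J}"] J K by (simp add: A_def measure_pmf_of_set)
    then have A0: "emeasure M A \<noteq> 0" "emeasure M A \<noteq> \<infinity>"
      using cK by (auto simp: emeasure_eq_measure)
    interpret C: prob_space C
      unfolding C_def by (rule prob_space_uniform_measure) (use A0 in auto)
    have signs: "C.indep_vars (\<lambda>_. borel) (\<lambda>j \<omega>. sgn (x \<omega> $ j)) J"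
      "\<And>j. j \<in> J \<Longrightarrow> C.prob {\<omega> \<in> space C. sgn (x \<omega> $ j) = 1} = 1 / 2"
      "\<And>j. j \<in> J \<Longrightarrow> C.prob {\<omega> \<in> space C. sgn (x \<omega> $ j) = - 1} = 1 / 2"
      using assms(12) J(1) by (simp_all add: generic_signal_def K_def Let_def C_def A_def)
    have "b J i $ j = 0" if "j \<notin> J" for j
      using arg_cong[OF supp[OF J(2), of i], of "\<lambda>v. v $ j"] that by (simp add: restrict_vec_def)
    then have "(\<Sum>j\<in>UNIV. (b J i $ j)\<^sup>2) = (\<Sum>j\<in>UNIV. if j \<in> J then (b J i $ j)\<^sup>2 else 0)"
      by (intro sum.cong) auto
    then have "(norm (b J i))\<^sup>2 = (\<Sum>j\<in>UNIV. if j \<in> J then (b J i $ j)\<^sup>2 else 0)"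
      by (simp add: norm_vec_def L2_set_def sum_nonneg)
    then have sq: "(\<Sum>j\<in>J. (b J i $ j)\<^sup>2) = (norm (b J i))\<^sup>2"
      by (simp add: sum.If_cases)
    define t where "t = coherence \<Phi> J i"
    have t: "(1 - \<delta>) * norm (b J i) \<le> t" unfolding t_def by (rule norm_b[OF J(2)])
    have "0 < (1 - \<delta>) * norm (b J i)" using False \<open>\<delta> < 1\<close> by simp
    with t have "0 < t" by linarith
    have "(1 - \<delta>)\<^sup>2 * (norm (b J i))\<^sup>2 \<le> t\<^sup>2"
      using t \<open>\<delta> < 1\<close> by (simp flip: power_mult_distrib add: power_mono)
    \<comment> \<open>The threshold 1/2 makes Hoeffding's exponent
      \<open>1 / (8 * (norm (b J i))\<^sup>2)\<close>, and the norm bound on \<open>b J i\<close>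
      turns this into the exponent of \<open>exp_weight\<close>. This is the origin of the 8
      there.\<close>
    then have exp_le: "exp (- ((1 / 2)\<^sup>2 / (2 * (norm (b J i))\<^sup>2))) \<le> w J i"
      using \<open>0 < t\<close> False by (simp add: w_def exp_weight_def flip: t_def) (simp add: field_simps)
    have "bad J i = A \<inter> {\<omega> \<in> space M. 1 / 2 < \<bar>\<Sum>j\<in>J. b J i $ j * sgn (x \<omega> $ j)\<bar>}"
      by (auto simp: bad_def A_def)
    then have "prob (bad J i)
        = prob A * C.prob {\<omega> \<in> space M. 1 / 2 < \<bar>\<Sum>j\<in>J. b J i $ j * sgn (x \<omega> $ j)\<bar>}"
      using prob_A cK unfolding C_def by (subst measure_uniform_measure[OF A0]) auto
    also have "\<dots> \<le> prob A * C.prob {\<omega> \<in> space C. 1 / 2 \<le> \<bar>\<Sum>j\<in>J. b J i $ j * sgn (x \<omega> $ j)\<bar>}"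
      by (intro mult_left_mono C.finite_measure_mono) (auto simp: C_def)
    also have "\<dots> \<le> prob A * (2 * w J i)"
      using C.random_signs_tail_bound[OF _ signs, of "1 / 2" "\<lambda>j. b J i $ j"] False exp_le
      by (intro mult_left_mono) (auto simp: sq)
    finally show ?thesis by (simp add: prob_A)
  qed
  define N where "N = real CARD('n)"
  have N: "1 \<le> N" unfolding N_def using assms(3) by linarith
  let ?X = "incoherence_exceptions k \<alpha> \<Phi>"
  have X: "?X \<subseteq> K" by (auto simp: incoherence_exceptions_def K_def)
  \<comment> \<open>\<alpha> is the squared coherence at which the weight equals
    \<open>\<epsilon> / (2 * N)\<close>. Since the weight increases with coherence, unexceptional
    supports stay below this value.\<close>
  have w_le: "w J i \<le> \<epsilon> / (2 * N)" if "J \<in> K - ?X" "i \<in> - J" for J i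
  proof (cases "coherence \<Phi> J i = 0")
    case True
    then show ?thesis using \<open>0 < \<epsilon>\<close> N by (simp add: w_def exp_weight_def)
  next
    case False
    define t where "t = coherence \<Phi> J i"
    have L: "0 < ln (2 * N / \<epsilon>)"
      using N \<open>0 < \<epsilon>\<close> \<open>\<epsilon> < 1\<close> by (intro ln_gt_zero) (simp add: field_simps)
    have "t\<^sup>2 \<le> \<alpha>"
      using that by (auto simp: t_def incoherence_exceptions_def K_def not_less)
    then have "ln (2 * N / \<epsilon>) \<le> (1 - \<delta>)\<^sup>2 / (8 * t\<^sup>2)"
      using L False unfolding assms(8) N_def[symmetric] by (simp add: t_def field_simps)
    then have "w J i \<le> exp (- ln (2 * N / \<epsilon>))"
      using False by (simp add: w_def exp_weight_def t_def)
    also have "\<dots> = \<epsilon> / (2 * N)"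
      using N \<open>0 < \<epsilon>\<close> by (simp add: exp_minus)
    finally show ?thesis .
  qed
  have w0: "0 \<le> w J i" for J i by (simp add: w_def exp_weight_def)
  \<comment> \<open>Each unexceptional support contributes at most \<epsilon>/2, having fewer than
    \<open>N\<close> columns outside; the exceptional ones are bounded together by WSINC.\<close>
  have w_sum: "(\<Sum>J\<in>K. \<Sum>i\<in>- J. w J i) \<le> (\<epsilon> / 2 + \<epsilon>\<^sup>2) * card K"
  proof -
    have "(\<Sum>J\<in>K - ?X. \<Sum>i\<in>- J. w J i) \<le> (\<Sum>J\<in>K - ?X. \<epsilon> / 2)"
    proof (intro sum_mono)
      fix J assume J: "J \<in> K - ?X"
      have "(\<Sum>i\<in>- J. w J i) \<le> (\<Sum>i\<in>- J. \<epsilon> / (2 * N))"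
        using J by (intro sum_mono w_le)
      also have "\<dots> \<le> (\<Sum>i\<in>(UNIV :: 'n set). \<epsilon> / (2 * N))"
        using \<open>0 < \<epsilon>\<close> N by (intro sum_mono2) auto
      finally show "(\<Sum>i\<in>- J. w J i) \<le> \<epsilon> / 2"
        by (simp add: N_def)
    qed
    also have "\<dots> \<le> card K * (\<epsilon> / 2)"
      using \<open>0 < \<epsilon>\<close> by (simp add: card_mono)
    finally have "(\<Sum>J\<in>K - ?X. \<Sum>i\<in>- J. w J i) \<le> card K * (\<epsilon> / 2)" .
    moreover have "(\<Sum>J\<in>?X. \<Sum>i\<in>- J. w J i) \<le> \<epsilon>\<^sup>2 * card K"
      using assms(10) unfolding WSINC_iff[OF assms(3)] by (simp add: w_def K_def)
    ultimately show ?thesis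
      using sum.subset_diff[OF X, of "\<lambda>J. \<Sum>i\<in>- J. w J i"] by (simp add: algebra_simps)
  qed
  \<comment> \<open>\<open>xh\<close> is not assumed measurable, so the recovery event itself might
    not be. The complement of the measurable failure event \<open>F\<close> serves as the witness
    \<open>E\<close>.\<close>
  define F where "F = {\<omega> \<in> space M. I \<omega> \<in> - G} \<union> (\<Union>J\<in>K \<inter> G. \<Union>i\<in>- J. bad J i)"
  have F [measurable]: "F \<in> events" unfolding F_def by measurable
  have "prob {\<omega> \<in> space M. I \<omega> \<in> - G} \<le> \<epsilon>"
  proof -
    have "measure_pmf.prob (pmf_of_set K) (- G) = 1 - measure_pmf.prob (pmf_of_set K) G"
      using measure_pmf.prob_compl[of G "pmf_of_set K"] by (simp add: Compl_eq_Diff_UNIV)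
    then show ?thesis
      using assms(9) unfolding prob_I by (simp add: StRIP_def G_def K_def)
  qed
  moreover have "prob (\<Union>J\<in>K \<inter> G. \<Union>i\<in>- J. bad J i) \<le> \<epsilon> + 2 * \<epsilon>\<^sup>2"
  proof -
    have "prob (\<Union>J\<in>K \<inter> G. \<Union>i\<in>- J. bad J i) \<le> (\<Sum>J\<in>K \<inter> G. prob (\<Union>i\<in>- J. bad J i))"
      by (intro finite_measure_subadditive_finite) auto
    also have "\<dots> \<le> (\<Sum>J\<in>K \<inter> G. \<Sum>i\<in>- J. prob (bad J i))"
      by (intro sum_mono finite_measure_subadditive_finite) auto
    also have "\<dots> \<le> (\<Sum>J\<in>K \<inter> G. \<Sum>i\<in>- J. 2 * w J i / card K)"
      by (intro sum_mono bad_le) auto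
    also have "\<dots> \<le> (\<Sum>J\<in>K. \<Sum>i\<in>- J. 2 * w J i / card K)"
      by (intro sum_mono2 sum_nonneg) (auto simp: w0)
    also have "\<dots> = 2 * (\<Sum>J\<in>K. \<Sum>i\<in>- J. w J i) / card K"
      by (simp add: sum_distrib_left sum_divide_distrib)
    also have "\<dots> \<le> \<epsilon> + 2 * \<epsilon>\<^sup>2"
      using w_sum cK by (simp add: field_simps)
    finally show ?thesis .
  qed
  \<comment> \<open>The two contributions add up to
    \<open>2 * \<epsilon> + 2 * \<epsilon>\<^sup>2\<close>, which this brings below
    \<open>4 * \<epsilon>\<close>.\<close>
  moreover have "\<epsilon>\<^sup>2 \<le> \<epsilon>"
    using \<open>0 < \<epsilon>\<close> \<open>\<epsilon> < 1\<close> by (simp add: power2_eq_square mult_left_le)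
  ultimately have "prob F \<le> 4 * \<epsilon>"
    unfolding F_def by (intro order_trans[OF measure_Un_le]) auto
  then have "1 - 4 * \<epsilon> \<le> prob (space M - F)"
    by (simp add: prob_compl)
  moreover have "l1_norm (restrict_vec (- I \<omega>) (x \<omega>) - restrict_vec (- I \<omega>) (xh \<omega>))
      \<le> 4 * best_sparse_l1_error k (x \<omega>)" if \<omega>: "\<omega> \<in> space M - F" for \<omega>
  proof -
    have IK: "I \<omega> \<in> K"
      using largest[of \<omega>] \<omega> by (simp add: largest_coords_def K_def k_subsets_def)
    have IG: "I \<omega> \<in> G" using \<omega> by (auto simp: F_def)
    have "\<bar>\<Sum>j\<in>I \<omega>. b (I \<omega>) i $ j * sgn (x \<omega> $ j)\<bar> \<le> 1 / 2" if "i \<in> - I \<omega>" for i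
      using \<omega> IK IG that by (auto simp: F_def bad_def not_less)
    then have "(\<Sum>i\<in>- I \<omega>. \<bar>x \<omega> $ i - xh \<omega> $ i\<bar>) \<le> 4 * (\<Sum>i\<in>- I \<omega>. \<bar>x \<omega> $ i\<bar>)"
      using assms(13,14)[of \<omega>] \<omega> by (intro basis_pursuit_error_le[OF _ ker_b[OF IG]]) auto
    also have "\<dots> \<le> 4 * best_sparse_l1_error k (x \<omega>)"
      using tail_le_best_sparse_l1_error[OF largest] \<omega> by simp
    also have "(\<Sum>i\<in>- I \<omega>. \<bar>x \<omega> $ i - xh \<omega> $ i\<bar>)
        = l1_norm (restrict_vec (- I \<omega>) (x \<omega> - xh \<omega>))"
      by (simp add: l1_norm_restrict_vec)
    also have "restrict_vec (- I \<omega>) (x \<omega> - xh \<omega>)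
        = restrict_vec (- I \<omega>) (x \<omega>) - restrict_vec (- I \<omega>) (xh \<omega>)"
      by (simp add: vec_eq_iff restrict_vec_def)
    finally show ?thesis .
  qed
  ultimately show ?thesis using F by blast
qed

end
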